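(* Let $n\ge1$ be a fixed integer and $p\in(0,1]$ a fixed constant. Let $\mathfrak I\sim\mathcal I(n,D,p)$ and let $\beta_1(S/\mathfrak I)$ be the random variable denoting the number of minimal generators of $\mathfrak I$. Then $$\lim_{D\to\infty}\mathbb E[\beta_1(S/\mathfrak I)]=p\sum_{k=0}^{\infty}\tau_n(k+2)(1-p)^k.$$
   Context: Let $S=K[x_1,\dots,x_n]$ with $K$ a field. $\mathcal B(n,D,p)$ is the distribution of the random set $\mathfrak B$ of monomials of $S$ obtained by including each non-constant monomial of total degree at most $D$ independently with probability $p$. $\mathcal I(n,D,p)$ is the distribution of the random monomial ideal $\mathfrak I=(\mathfrak B)$, with $\mathfrak I=(0)$ if $\mathfrak B=\emptyset$. The order $r$ divisor function $\tau_r(m)$ is the number of ordered factorizations of the positive integer $m$ into exactly $r$ positive integer factors, i.e. the number of $r$-tuples of positive integers with product $m$ (e.g. $\tau_3(4)=6$). Convention: $0^0=1$. *)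

theory Defs
  imports "HOL-Probability.Probability" "HOL-Library.Poly_Mapping"
begin

text \<open>
  The polynomial ring \<open>S = K[x\<^sub>1, \<dots>, x\<^sub>n]\<close> is the type of finitely supported functions from
  exponent vectors to \<open>K\<close>, with the convolution product; the variables are indexed by a
  finite type \<open>'n\<close>, so that \<open>n = CARD('n) \<ge> 1\<close>.
\<close>

type_synonym ('n, 'k) mpoly = "('n \<Rightarrow>\<^sub>0 nat) \<Rightarrow>\<^sub>0 'k"

definition monomial :: "('n \<Rightarrow>\<^sub>0 nat) \<Rightarrow> ('n, 'k::field) mpoly" where
  "monomial a = Poly_Mapping.single a 1"

definition total_degree :: "('n::finite \<Rightarrow>\<^sub>0 nat) \<Rightarrow> nat" where
  "total_degree a = (\<Sum>i\<in>UNIV. Poly_Mapping.lookup a i)"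

definition nonconst_monomials :: "nat \<Rightarrow> ('n::finite, 'k::field) mpoly set" where
  "nonconst_monomials D = monomial ` {a. a \<noteq> 0 \<and> total_degree a \<le> D}"

text \<open>An ideal is a submodule of the ring regarded as a module over itself.\<close>

definition ideal_of :: "('n::finite, 'k::field) mpoly set \<Rightarrow> ('n, 'k) mpoly set" where
  "ideal_of = module.span (*)"

definition random_monomials :: "nat \<Rightarrow> real \<Rightarrow> ('n::finite, 'k::field) mpoly set pmf" where
  "random_monomials D p =
     map_pmf (\<lambda>f. {m \<in> nonconst_monomials D. f m})
       (Pi_pmf (nonconst_monomials D) False (\<lambda>_. bernoulli_pmf p))"

definition random_monomial_ideal :: "nat \<Rightarrow> real \<Rightarrow> ('n::finite, 'k::field) mpoly set pmf" where
  "random_monomial_ideal D p = map_pmf ideal_of (random_monomials D p)"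

definition minimal_monomial_generators ::
    "('n::finite, 'k::field) mpoly set \<Rightarrow> ('n, 'k) mpoly set \<Rightarrow> bool" where
  "minimal_monomial_generators I G \<longleftrightarrow>
     G \<subseteq> range monomial \<and> ideal_of G = I \<and> (\<forall>H. H \<subset> G \<longrightarrow> ideal_of H \<noteq> I)"

text \<open>
  The number of minimal generators of a monomial ideal \<open>I\<close>, i.e. \<open>\<beta>\<^sub>1(S/I)\<close>. The description is
  well-defined by the lemma \<open>ex1_minimal_monomial_generators\<close> below.
\<close>

definition beta1 :: "('n::finite, 'k::field) mpoly set \<Rightarrow> nat" where
  "beta1 I = card (THE G. minimal_monomial_generators I G)"

definition tau :: "nat \<Rightarrow> nat \<Rightarrow> nat" where
  "tau r m = card {xs :: nat list. length xs = r \<and> (\<forall>x\<in>set xs. x > 0) \<and> prod_list xs = m}"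

lemma finite_nonconst_monomials: "finite (nonconst_monomials D :: ('n::finite, 'k::field) mpoly set)"
proof -
  have "Poly_Mapping.lookup ` {a :: 'n \<Rightarrow>\<^sub>0 nat. a \<noteq> 0 \<and> total_degree a \<le> D}
      \<subseteq> Pi UNIV (\<lambda>_. {..D})"
  proof (clarsimp simp: Pi_def)
    fix a :: "'n \<Rightarrow>\<^sub>0 nat" and i :: 'n assume "total_degree a \<le> D"
    moreover have "Poly_Mapping.lookup a i \<le> total_degree a"
      unfolding total_degree_def by (rule member_le_sum) auto
    ultimately show "Poly_Mapping.lookup a i \<le> D" by simp
  qed
  also have "Pi UNIV (\<lambda>_. {..D}) = PiE (UNIV :: 'n set) (\<lambda>_. {..D})"
    by (simp add: PiE_UNIV_domain Pi_def)
  finally have "finite (Poly_Mapping.lookup ` {a :: 'n \<Rightarrow>\<^sub>0 nat. a \<noteq> 0 \<and> total_degree a \<le> D})"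
    by (rule finite_subset) (intro finite_PiE, auto)
  then have "finite {a :: 'n \<Rightarrow>\<^sub>0 nat. a \<noteq> 0 \<and> total_degree a \<le> D}"
    by (rule finite_imageD) (rule inj_onI, simp add: lookup_inject)
  then show ?thesis
    by (simp add: nonconst_monomials_def)
qed

interpretation mpoly_module: module "(*) :: ('n::finite, 'k::field) mpoly \<Rightarrow> _"
  rewrites "module.span ((*) :: ('n, 'k) mpoly \<Rightarrow> _) = ideal_of"
proof -
  show "module ((*) :: ('n, 'k) mpoly \<Rightarrow> _)"
    by unfold_locales (simp_all add: algebra_simps)
qed (simp add: ideal_of_def)

lemma monomial_in_ideal_of_iff:
  fixes E :: "('n::finite \<Rightarrow>\<^sub>0 nat) set"
  shows "(monomial a :: ('n, 'k::field) mpoly) \<in> ideal_of (monomial ` E) \<longleftrightarrow> (\<exists>e\<in>E. \<exists>c. a = c + e)"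
proof
  let ?V = "{f :: ('n, 'k) mpoly. \<forall>b\<in>Poly_Mapping.keys f. \<exists>e\<in>E. \<exists>c. b = c + e}"
  have "mpoly_module.subspace ?V"
  proof (rule mpoly_module.subspaceI)
    fix x y :: "('n, 'k) mpoly" assume "x \<in> ?V" "y \<in> ?V"
    then show "x + y \<in> ?V" using Poly_Mapping.keys_add[of x y] by blast
  next
    fix c x :: "('n, 'k) mpoly" assume x: "x \<in> ?V"
    show "c * x \<in> ?V"
    proof (intro CollectI ballI)
      fix b assume "b \<in> Poly_Mapping.keys (c * x)"
      then obtain u v where "b = u + v" "v \<in> Poly_Mapping.keys x"
        using keys_mult[of c x] by blast
      moreover from this x obtain e w where "e \<in> E" "v = w + e"
        by blast
      ultimately have "e \<in> E" "b = (u + w) + e"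
        by (simp_all add: add.assoc)
      then show "\<exists>e\<in>E. \<exists>c. b = c + e"
        by blast
    qed
  qed simp
  moreover have "monomial ` E \<subseteq> ?V"
    by (auto simp: monomial_def intro!: exI[of _ 0])
  ultimately have "ideal_of (monomial ` E) \<subseteq> ?V"
    by (intro mpoly_module.span_minimal)
  moreover assume "(monomial a :: ('n, 'k) mpoly) \<in> ideal_of (monomial ` E)"
  ultimately show "\<exists>e\<in>E. \<exists>c. a = c + e"
    by (auto simp: monomial_def)
next
  assume "\<exists>e\<in>E. \<exists>c. a = c + e"
  then obtain e c where "e \<in> E" "a = c + e" by blast
  moreover have "(monomial (c + e) :: ('n, 'k) mpoly) = monomial c * monomial e"
    by (simp add: monomial_def mult_single)
  ultimately show "(monomial a :: ('n, 'k) mpoly) \<in> ideal_of (monomial ` E)"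
    by (simp add: mpoly_module.span_base mpoly_module.span_scale)
qed

lemma minimal_monomial_generators_subset:
  fixes I :: "('n::finite, 'k::field) mpoly set"
  assumes G: "minimal_monomial_generators I G" and H: "minimal_monomial_generators I H"
  shows "G \<subseteq> H"
proof
  fix g assume g: "g \<in> G"
  obtain E F where E: "G = monomial ` E" and F: "H = monomial ` F"
    using G H by (meson minimal_monomial_generators_def subset_image_iff)
  have I: "ideal_of (monomial ` E) = I" "ideal_of (monomial ` F) = I"
    using G H E F by (auto simp: minimal_monomial_generators_def)
  obtain a where a: "a \<in> E" "g = monomial a" using g E by blast
  have div: "\<exists>v\<in>V. \<exists>c. u = c + v"
    if "u \<in> U" "ideal_of (monomial ` U) = I" "ideal_of (monomial ` V) = I" for u U V
  proof -
    have "(monomial u :: ('n, 'k) mpoly) \<in> ideal_of (monomial ` U)"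
      by (rule mpoly_module.span_base) (use that(1) in blast)
    then have "(monomial u :: ('n, 'k) mpoly) \<in> ideal_of (monomial ` V)"
      unfolding that(2,3) .
    then show ?thesis by (simp add: monomial_in_ideal_of_iff)
  qed
  obtain f c where f: "f \<in> F" "a = c + f" using div[OF a(1) I] by blast
  obtain e d where e: "e \<in> E" "f = d + e" using div[OF f(1) I(2,1)] by blast
  have "e = a"
  proof (rule ccontr)
    assume "e \<noteq> a"
    then have "e \<in> E - {a}" "a = (c + d) + e"
      using e f by (simp_all add: add.assoc)
    then have "(monomial a :: ('n, 'k) mpoly) \<in> ideal_of (monomial ` (E - {a}))"
      unfolding monomial_in_ideal_of_iff by blast
    moreover have "monomial ` E = insert (monomial a :: ('n, 'k) mpoly) (monomial ` (E - {a}))"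
      using a by blast
    ultimately have "monomial ` E \<subseteq> ideal_of (monomial ` (E - {a}) :: ('n, 'k) mpoly set)"
      using mpoly_module.span_superset[of "monomial ` (E - {a})"] by auto
    then have "I \<subseteq> ideal_of (monomial ` (E - {a}))"
      unfolding I(1)[symmetric] by (intro mpoly_module.span_minimal mpoly_module.subspace_span)
    moreover have "ideal_of (monomial ` (E - {a})) \<subseteq> I"
      unfolding I(1)[symmetric] by (rule mpoly_module.span_mono) auto
    ultimately have "ideal_of (monomial ` (E - {a})) = I"
      by blast
    moreover have "inj (monomial :: _ \<Rightarrow> ('n, 'k) mpoly)"
      by (auto simp: inj_def monomial_def dest: arg_cong[where f = Poly_Mapping.keys])
    then have "(monomial a :: ('n, 'k) mpoly) \<notin> monomial ` (E - {a})"
      by (simp add: inj_image_mem_iff)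
    then have "monomial ` (E - {a}) \<subset> (monomial ` E :: ('n, 'k) mpoly set)"
      using a by blast
    ultimately show False
      using G E by (auto simp: minimal_monomial_generators_def)
  qed
  then have "(c + d) + a = 0 + a" using e f by (simp add: add.assoc)
  then have cd: "c + d = 0" by (rule add_right_imp_eq)
  have "c = 0"
  proof (rule poly_mapping_eqI)
    fix i
    show "Poly_Mapping.lookup c i = Poly_Mapping.lookup 0 i"
      using arg_cong[OF cd, of "\<lambda>x. Poly_Mapping.lookup x i"] by (simp add: lookup_add)
  qed
  then show "g \<in> H" using a f F by simp
qed

lemma ex1_minimal_monomial_generators:
  fixes B :: "('n::finite, 'k::field) mpoly set"
  assumes "finite B" "B \<subseteq> range monomial"
  shows "\<exists>!G. minimal_monomial_generators (ideal_of B) G"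
proof (rule ex_ex1I)
  let ?P = "\<lambda>G. G \<subseteq> B \<and> ideal_of G = ideal_of B"
  obtain G where G: "?P G" "\<And>H. ?P H \<Longrightarrow> card G \<le> card H"
    using ex_has_least_nat[of ?P B card] by blast
  have "minimal_monomial_generators (ideal_of B) G"
    unfolding minimal_monomial_generators_def
  proof (intro conjI allI impI)
    fix H assume H: "H \<subset> G"
    then have "card H < card G"
      using G(1) assms(1) by (meson finite_subset psubset_card_mono)
    then show "ideal_of H \<noteq> ideal_of B"
      using G H by (meson leD psubset_imp_subset subset_trans)
  qed (use G assms in auto)
  then show "\<exists>G. minimal_monomial_generators (ideal_of B) G" ..
next
  fix G H
  assume "minimal_monomial_generators (ideal_of B) G" "minimal_monomial_generators (ideal_of B) H"
  then show "G = H"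
    using minimal_monomial_generators_subset[of "ideal_of B" G H]
      minimal_monomial_generators_subset[of "ideal_of B" H G] by blast
qed

end

theory Submission
  imports Defs "HOL-Real_Asymp.Real_Asymp"
begin

text \<open>
  A minimal generator of \<open>I = (B)\<close> is a monomial \<open>x\<^sup>a\<close> that lies in \<open>B\<close> while none of its proper
  non-constant divisors does. All divisors of \<open>x\<^sup>a\<close> have degree at most \<open>\<bar>a\<bar>\<close>, so for \<open>\<bar>a\<bar> \<le> D\<close>
  every one of them takes part in the random choice. Writing \<open>d(a) = (a\<^sub>1 + 1) \<cdots> (a\<^sub>n + 1)\<close> for the
  number of divisors of \<open>x\<^sup>a\<close>, of which \<open>1\<close> and \<open>x\<^sup>a\<close> itself are excluded, independence gives
  probability \<open>p q\<^bsup>d(a) - 2\<^esup>\<close> with \<open>q = 1 - p\<close> (lemma \<open>prob_minimal_exponent\<close>), and by linearity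
  \<open>E[\<beta>\<^sub>1(S/I)] = p \<Sum> q\<^bsup>d(a) - 2\<^esup>\<close>, summed over \<open>0 < \<bar>a\<bar> \<le> D\<close> (lemma \<open>expectation_beta1\<close>).

  The vectors \<open>a\<close> with \<open>d(a) = m\<close> are the ordered factorizations of \<open>m\<close> into \<open>n\<close> factors
  (lemma \<open>tau_eq_card_divisor_count\<close>), so summing by the value \<open>d(a) = k + 2\<close> instead of by degree
  turns the same terms into the series \<open>\<Sum>\<^sub>k \<tau>\<^sub>n(k + 2) q\<^sup>k\<close>, which converges because
  \<open>\<tau>\<^sub>n(m)\<close> grows at most polynomially in \<open>m\<close>. As \<open>\<bar>a\<bar> < d(a)\<close>, the vectors with
  \<open>2 \<le> d(a) < D + 2\<close> all satisfy \<open>0 < \<bar>a\<bar> \<le> D\<close>. Since all terms are nonnegative, the truncation by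
  degree lies between the \<open>D\<close>-th partial sum and the sum of the series, and the limit follows by
  squeezing.
\<close>

section \<open>Divisors of a monomial\<close>

text \<open>Exponent vectors stand for monomials; divisibility has the shape that membership in a monomial
  ideal has in \<open>monomial_in_ideal_of_iff\<close>, and is componentwise order by \<open>mem_divisors_iff\<close>.\<close>

definition divisors :: "('n::finite \<Rightarrow>\<^sub>0 nat) \<Rightarrow> ('n \<Rightarrow>\<^sub>0 nat) set" where
  "divisors a = {b. \<exists>c. a = c + b}"

text \<open>The product formula for the number of divisors, justified by \<open>divisors_finite_card\<close>.\<close>

definition divisor_count :: "('n::finite \<Rightarrow>\<^sub>0 nat) \<Rightarrow> nat" where
  "divisor_count a = (\<Prod>i\<in>UNIV. Suc (Poly_Mapping.lookup a i))"

lemma bij_lookup: "bij (Poly_Mapping.lookup :: ('n::finite \<Rightarrow>\<^sub>0 'b::zero) \<Rightarrow> _)"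
proof (rule bijI)
  show "inj (Poly_Mapping.lookup :: ('n \<Rightarrow>\<^sub>0 'b) \<Rightarrow> _)"
    by (simp add: inj_def lookup_inject)
  have "f = Poly_Mapping.lookup (Abs_poly_mapping f)" for f :: "'n \<Rightarrow> 'b"
    by simp
  then show "surj (Poly_Mapping.lookup :: ('n \<Rightarrow>\<^sub>0 'b) \<Rightarrow> _)"
    by (rule surjI[OF sym])
qed

lemma mem_divisors_iff:
  "b \<in> divisors a \<longleftrightarrow> (\<forall>i. Poly_Mapping.lookup b i \<le> Poly_Mapping.lookup a i)"
proof
  assume "b \<in> divisors a"
  then show "\<forall>i. Poly_Mapping.lookup b i \<le> Poly_Mapping.lookup a i"
    by (auto simp: divisors_def lookup_add)
next
  assume "\<forall>i. Poly_Mapping.lookup b i \<le> Poly_Mapping.lookup a i"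
  then have "a = (a - b) + b"
    by (intro poly_mapping_eqI) (simp add: lookup_add lookup_minus)
  then show "b \<in> divisors a"
    unfolding divisors_def by blast
qed

lemma divisors_refl: "a \<in> divisors a" and zero_in_divisors: "0 \<in> divisors a"
  by (simp_all add: mem_divisors_iff)

lemma divisors_trans: "c \<in> divisors b \<Longrightarrow> b \<in> divisors a \<Longrightarrow> c \<in> divisors a"
  by (meson mem_divisors_iff order_trans)

lemma total_degree_divisor_le: "b \<in> divisors a \<Longrightarrow> total_degree b \<le> total_degree a"
  by (auto simp: mem_divisors_iff total_degree_def intro: sum_mono)

lemma total_degree_proper_divisor_less:
  assumes "b \<in> divisors a" "b \<noteq> a"
  shows "total_degree b < total_degree a"
proof -
  obtain i where "Poly_Mapping.lookup b i \<noteq> Poly_Mapping.lookup a i"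
    using assms(2) by (metis poly_mapping_eqI)
  then show ?thesis
    using assms(1) unfolding total_degree_def
    by (intro sum_strict_mono_ex1) (auto simp: mem_divisors_iff order.strict_iff_order)
qed

text \<open>A divisor is a free choice, for each variable, of an exponent between \<open>0\<close> and the exponent of that
  variable in \<open>a\<close>.\<close>

lemma divisors_finite_card:
  "finite (divisors a) \<and> card (divisors a) = divisor_count a"
proof -
  let ?P = "PiE UNIV (\<lambda>i. {..Poly_Mapping.lookup a i})"
  have eq: "divisors a = Poly_Mapping.lookup -` ?P"
    by (auto simp: mem_divisors_iff PiE_UNIV_domain Pi_iff)
  have "finite ?P" by (intro finite_PiE) auto
  then have "finite (divisors a)"
    unfolding eq by (rule finite_vimageI) (rule bij_is_inj[OF bij_lookup])
  moreover have "card (divisors a) = card ?P"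
    unfolding eq using bij_lookup by (intro card_vimage_inj) (auto simp: bij_def)
  ultimately show ?thesis
    by (simp add: card_PiE divisor_count_def)
qed

text \<open>Expanding \<open>\<Prod>\<^sub>i (1 + a\<^sub>i)\<close> yields \<open>1 + \<Sum>\<^sub>i a\<^sub>i\<close> and further nonnegative terms. This comparison
  bounds degrees by divisor counts, hence also makes every set of vectors with bounded divisor
  count finite.\<close>

lemma total_degree_less_divisor_count: "total_degree a < divisor_count a"
proof -
  have "Suc (\<Sum>i\<in>A. f i) \<le> (\<Prod>i\<in>A. Suc (f i))" if "finite A" for A and f :: "'a \<Rightarrow> nat"
    using that
  proof induction
    case (insert x A)
    have "Suc (\<Sum>i\<in>insert x A. f i) \<le> Suc (f x) * Suc (\<Sum>i\<in>A. f i)"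
      using insert by simp
    also have "\<dots> \<le> Suc (f x) * (\<Prod>i\<in>A. Suc (f i))"
      using insert.IH by (rule mult_le_mono2)
    finally show ?case using insert by simp
  qed simp
  from this[of UNIV "Poly_Mapping.lookup a"] show ?thesis
    by (simp add: total_degree_def divisor_count_def)
qed

lemma divisor_count_ge_2:
  assumes "a \<noteq> 0" shows "2 \<le> divisor_count a"
  using card_mono[of "divisors a" "{0, a}"] assms divisors_finite_card[of a]
  by (auto simp: divisors_refl zero_in_divisors)

lemma divisor_count_zero: "divisor_count 0 = 1"
  by (simp add: divisor_count_def)

lemma card_proper_nonconst_divisors:
  assumes "a \<noteq> 0"
  shows "card (divisors a - {0, a}) = divisor_count a - 2"
  using assms divisors_finite_card[of a]
  by (subst card_Diff_subset) (auto simp: divisors_refl zero_in_divisors)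

section \<open>Counting exponent vectors by their number of divisors\<close>

text \<open>The vector \<open>a\<close> corresponds to the factorization with factors \<open>a\<^sub>i + 1\<close>, listed in some fixed
  enumeration of the variables; conversely, positive factors are lowered by one.\<close>

lemma tau_eq_card_divisor_count:
  "tau CARD('n) m = card {a :: 'n::finite \<Rightarrow>\<^sub>0 nat. divisor_count a = m}"
proof -
  obtain us :: "'n list" where us: "set us = UNIV" "distinct us"
    using finite_distinct_list[OF finite] by blast
  have len: "length us = CARD('n)"
    using distinct_card[OF us(2)] us(1) by simp
  let ?h = "\<lambda>a :: 'n \<Rightarrow>\<^sub>0 nat. map (\<lambda>i. Suc (Poly_Mapping.lookup a i)) us"
  let ?L = "{xs :: nat list. length xs = CARD('n) \<and> (\<forall>x\<in>set xs. x > 0) \<and> prod_list xs = m}"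
  have prod: "prod_list (?h a) = divisor_count a" for a
    using prod.distinct_set_conv_list[OF us(2), symmetric] us(1)
    by (simp add: divisor_count_def)
  have "bij_betw ?h {a. divisor_count a = m} ?L"
  proof (rule bij_betwI')
    fix a b :: "'n \<Rightarrow>\<^sub>0 nat"
    show "?h a = ?h b \<longleftrightarrow> a = b"
      using us(1) by (auto intro: poly_mapping_eqI)
  next
    fix a :: "'n \<Rightarrow>\<^sub>0 nat" assume "a \<in> {a. divisor_count a = m}"
    then show "?h a \<in> ?L"
      using len prod[of a] by auto
  next
    fix xs assume xs: "xs \<in> ?L"
    define g where "g i = the (map_of (zip us xs) i) - 1" for i
    have "map (\<lambda>i. the (map_of (zip us xs) i)) us = xs"
      using xs us(2) len by (intro nth_equalityI) (auto simp: map_of_zip_nth)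
    moreover have "map (\<lambda>i. the (map_of (zip us xs) i)) us = ?h (Abs_poly_mapping g)"
    proof (rule map_cong[OF refl])
      fix i assume "i \<in> set us"
      then have "the (map_of (zip us xs) i) \<in> set xs"
        using calculation by (metis image_eqI list.set_map)
      then have "the (map_of (zip us xs) i) > 0"
        using xs by blast
      then show "the (map_of (zip us xs) i) = Suc (Poly_Mapping.lookup (Abs_poly_mapping g) i)"
        by (simp add: g_def)
    qed
    ultimately show "\<exists>a\<in>{a. divisor_count a = m}. xs = ?h a"
      using prod[of "Abs_poly_mapping g"] xs by auto
  qed
  from bij_betw_same_card[OF this] show ?thesis
    by (simp only: tau_def)
qed

lemma finite_total_degree_le: "finite {a :: 'n::finite \<Rightarrow>\<^sub>0 nat. total_degree a \<le> D}"
proof (rule finite_subset)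
  show "{a :: 'n \<Rightarrow>\<^sub>0 nat. total_degree a \<le> D} \<subseteq> Poly_Mapping.lookup -` (PiE UNIV (\<lambda>_. {..D}))"
  proof (clarsimp simp: PiE_UNIV_domain)
    fix a :: "'n \<Rightarrow>\<^sub>0 nat" and i assume "total_degree a \<le> D"
    moreover have "Poly_Mapping.lookup a i \<le> total_degree a"
      unfolding total_degree_def by (rule member_le_sum) auto
    ultimately show "Poly_Mapping.lookup a i \<le> D" by simp
  qed
  show "finite ((Poly_Mapping.lookup :: ('n \<Rightarrow>\<^sub>0 nat) \<Rightarrow> _) -` (PiE UNIV (\<lambda>_. {..D})))"
    by (intro finite_vimageI finite_PiE bij_is_inj[OF bij_lookup]) auto
qed

lemma finite_divisor_count_less: "finite {a :: 'n::finite \<Rightarrow>\<^sub>0 nat. divisor_count a < N}"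
  by (rule finite_subset[OF _ finite_total_degree_le[of N]])
    (use total_degree_less_divisor_count in \<open>auto intro: less_imp_le order.strict_trans\<close>)

text \<open>Every factor of a positive product is at most the product. The base is \<open>m + 1\<close> because the factors
  are counted inside \<open>{0..m}\<close>.\<close>

lemma tau_le_power:
  "tau r m \<le> Suc m ^ r"
proof -
  have "tau r m \<le> card {xs. set xs \<subseteq> {..m} \<and> length xs = r}"
    unfolding tau_def
  proof (rule card_mono)
    show "{xs. length xs = r \<and> (\<forall>x\<in>set xs. x > 0) \<and> prod_list xs = m}
        \<subseteq> {xs. set xs \<subseteq> {..m} \<and> length xs = r}"
    proof clarsimp
      fix xs :: "nat list" and x assume pos: "\<forall>x\<in>set xs. 0 < x" and "x \<in> set xs"
      then obtain ys zs where "xs = ys @ x # zs"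
        by (meson split_list)
      then have "x dvd prod_list xs" by simp
      moreover have "prod_list xs > 0"
        using pos by (auto intro!: gr0I simp: prod_list_zero_iff)
      ultimately show "x \<le> prod_list xs" by (rule dvd_imp_le)
    qed
  qed (simp add: finite_lists_length_eq)
  then show ?thesis by (simp add: card_lists_length_eq)
qed

lemma summable_tau_power:
  fixes q :: real
  assumes "0 \<le> q" "q < 1"
  shows "summable (\<lambda>k. real (tau r (k + 2)) * q ^ k)"
proof (rule summable_comparison_test_ev)
  show "\<forall>\<^sub>F k in sequentially. norm (real (tau r (k + 2)) * q ^ k) \<le> real (k + 3) ^ r * q ^ k"
  proof (intro always_eventually allI)
    fix k
    have "real (tau r (k + 2)) \<le> real (Suc (k + 2) ^ r)"
      using tau_le_power[of r "k + 2"] by (simp only: of_nat_le_iff)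
    then show "norm (real (tau r (k + 2)) * q ^ k) \<le> real (k + 3) ^ r * q ^ k"
      using assms by (auto simp: numeral_eq_Suc intro: mult_right_mono)
  qed
  show "summable (\<lambda>k. real (k + 3) ^ r * q ^ k)"
  proof -
    obtain c where c: "q < c" "c < 1" using dense[OF assms(2)] by blast
    \<comment> \<open>Ratio test for the dominating series: its ratios tend to \<open>q\<close>, so they drop below any \<open>c > q\<close>.\<close>
    have "(\<lambda>k. real (k + 4) / real (k + 3)) \<longlonglongrightarrow> 1" by real_asymp
    then have "(\<lambda>k. (real (k + 4) / real (k + 3)) ^ r * q) \<longlonglongrightarrow> 1 ^ r * q"
      by (intro tendsto_intros)
    then have "\<forall>\<^sub>F k in sequentially. (real (k + 4) / real (k + 3)) ^ r * q < c"
      using c by (intro order_tendstoD) auto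
    then obtain K where K: "\<And>k. k \<ge> K \<Longrightarrow> (real (k + 4) / real (k + 3)) ^ r * q < c"
      unfolding eventually_sequentially by blast
    show ?thesis
    proof (rule summable_ratio_test[OF c(2)])
      fix k assume "k \<ge> K"
      have "real (Suc k + 3) ^ r * q ^ Suc k =
          ((real (k + 4) / real (k + 3)) ^ r * q) * (real (k + 3) ^ r * q ^ k)"
        by (simp add: power_divide field_simps)
      also have "\<dots> \<le> c * (real (k + 3) ^ r * q ^ k)"
        using K[OF \<open>k \<ge> K\<close>] assms by (intro mult_right_mono) auto
      finally show "norm (real (Suc k + 3) ^ r * q ^ Suc k) \<le> c * norm (real (k + 3) ^ r * q ^ k)"
        using assms by simp
    qed
  qed
qed

text \<open>Partial sums of the series are sums over exponent vectors, grouped by their divisor count.\<close>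

lemma sum_tau_power:
  fixes q :: real
  shows "(\<Sum>k<N. real (tau CARD('n) (k + 2)) * q ^ k) =
    (\<Sum>a | 2 \<le> divisor_count (a :: 'n::finite \<Rightarrow>\<^sub>0 nat) \<and> divisor_count a < N + 2. q ^ (divisor_count a - 2))"
proof -
  let ?A = "{a :: 'n \<Rightarrow>\<^sub>0 nat. 2 \<le> divisor_count a \<and> divisor_count a < N + 2}"
  have fin: "finite ?A"
    by (rule finite_subset[OF _ finite_divisor_count_less[of "N + 2"]]) auto
  have "(\<Sum>a\<in>?A. q ^ (divisor_count a - 2)) =
      (\<Sum>k<N. \<Sum>a | a \<in> ?A \<and> divisor_count a - 2 = k. q ^ (divisor_count a - 2))"
    using fin by (intro sum.group[symmetric]) auto
  also have "\<dots> = (\<Sum>k<N. real (tau CARD('n) (k + 2)) * q ^ k)"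
  proof (rule sum.cong[OF refl])
    fix k assume "k \<in> {..<N}"
    then have "{a. a \<in> ?A \<and> divisor_count a - 2 = k} = {a. divisor_count a = k + 2}"
      by auto
    then show "(\<Sum>a | a \<in> ?A \<and> divisor_count a - 2 = k. q ^ (divisor_count a - 2)) =
        real (tau CARD('n) (k + 2)) * q ^ k"
      by (simp add: tau_eq_card_divisor_count[where 'n='n])
  qed
  finally show ?thesis ..
qed

section \<open>Minimal generators of a monomial ideal\<close>

lemma inj_monomial: "inj (monomial :: _ \<Rightarrow> ('n, 'k::field) mpoly)"
  by (auto simp: inj_def monomial_def dest: arg_cong[where f = Poly_Mapping.keys])

definition minimal_exponents :: "('n::finite \<Rightarrow>\<^sub>0 nat) set \<Rightarrow> ('n \<Rightarrow>\<^sub>0 nat) set" where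
  "minimal_exponents E = {a \<in> E. divisors a \<inter> E \<subseteq> {a}}"

text \<open>Passing to a proper divisor lowers the total degree, so the descent to a minimal element stops.\<close>

lemma ex_minimal_exponent_divisor:
  assumes "a \<in> E" shows "\<exists>b\<in>minimal_exponents E. b \<in> divisors a"
  using assms
proof (induction "total_degree a" arbitrary: a rule: less_induct)
  case less
  show ?case
  proof (cases "a \<in> minimal_exponents E")
    case True
    then show ?thesis using divisors_refl by blast
  next
    case False
    then obtain b where "b \<in> divisors a" "b \<in> E" "b \<noteq> a"
      using less.prems by (auto simp: minimal_exponents_def)
    then show ?thesis
      using less.hyps total_degree_proper_divisor_less divisors_trans by meson
  qed
qed

text \<open>The minimal exponents suffice because each exponent of \<open>E\<close> has a minimal one below it, and none can
  be dropped because a minimal exponent is divisible by no other element of \<open>E\<close>.\<close>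

lemma minimal_monomial_generators_minimal_exponents:
  fixes E :: "('n::finite \<Rightarrow>\<^sub>0 nat) set"
  shows "minimal_monomial_generators (ideal_of (monomial ` E) :: ('n, 'k::field) mpoly set)
    (monomial ` minimal_exponents E)"
  unfolding minimal_monomial_generators_def
proof (intro conjI allI impI)
  let ?m = "monomial :: _ \<Rightarrow> ('n, 'k) mpoly"
  have sub: "minimal_exponents E \<subseteq> E"
    by (auto simp: minimal_exponents_def)
  show "?m ` minimal_exponents E \<subseteq> range ?m" by blast
  have "?m ` E \<subseteq> ideal_of (?m ` minimal_exponents E)"
    using ex_minimal_exponent_divisor[of _ E]
    by (auto simp: monomial_in_ideal_of_iff divisors_def)
  then have "ideal_of (?m ` E) \<subseteq> ideal_of (?m ` minimal_exponents E)"
    by (intro mpoly_module.span_minimal mpoly_module.subspace_span)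
  moreover have "ideal_of (?m ` minimal_exponents E) \<subseteq> ideal_of (?m ` E)"
    using sub by (intro mpoly_module.span_mono image_mono)
  ultimately show "ideal_of (?m ` minimal_exponents E) = ideal_of (?m ` E)"
    by (rule subset_antisym[rotated])
  fix H assume H: "H \<subset> ?m ` minimal_exponents E"
  then obtain F where F: "F \<subseteq> minimal_exponents E" "H = ?m ` F"
    by (meson psubset_imp_subset subset_image_iff)
  then obtain a where a: "a \<in> minimal_exponents E" "a \<notin> F"
    using H by blast
  show "ideal_of H \<noteq> ideal_of (?m ` E)"
  proof
    assume "ideal_of H = ideal_of (?m ` E)"
    moreover have "?m a \<in> ideal_of (?m ` E)"
      using a sub by (intro mpoly_module.span_base) blast
    ultimately have "?m a \<in> ideal_of (?m ` F)"
      using F(2) by simp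
    then obtain e where "e \<in> F" "e \<in> divisors a"
      unfolding monomial_in_ideal_of_iff divisors_def by blast
    then have "e = a"
      using a F(1) by (auto simp: minimal_exponents_def)
    then show False using a \<open>e \<in> F\<close> by simp
  qed
qed

lemma beta1_eq_card_minimal_exponents:
  fixes E :: "('n::finite \<Rightarrow>\<^sub>0 nat) set"
  shows "beta1 (ideal_of (monomial ` E) :: ('n, 'k::field) mpoly set) = card (minimal_exponents E)"
proof -
  let ?m = "monomial :: _ \<Rightarrow> ('n, 'k) mpoly"
  have "(THE G. minimal_monomial_generators (ideal_of (?m ` E)) G) = ?m ` minimal_exponents E"
    using minimal_monomial_generators_minimal_exponents minimal_monomial_generators_subset
    by (intro the_equality subset_antisym) blast+
  then show ?thesis
    by (simp add: beta1_def card_image inj_on_subset[OF inj_monomial])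
qed

section \<open>The expected number of minimal generators\<close>

text \<open>The event prescribes the value of \<open>f\<close> at \<open>x\<^sup>a\<close> (included) and at each of its proper non-constant
  divisors (excluded), and nothing elsewhere. It is therefore a box, and its probability is the
  product of the probabilities of these independent choices.\<close>

lemma prob_minimal_exponent:
  fixes a :: "'n::finite \<Rightarrow>\<^sub>0 nat" and p :: real
  assumes "0 \<le> p" "p \<le> 1" and a: "a \<noteq> 0" "total_degree a \<le> D"
  shows "measure_pmf.prob
      (Pi_pmf (nonconst_monomials D :: ('n, 'k::field) mpoly set) False (\<lambda>_. bernoulli_pmf p))
      {f. a \<in> minimal_exponents {b. b \<noteq> 0 \<and> total_degree b \<le> D \<and> f (monomial b)}}
    = p * (1 - p) ^ (divisor_count a - 2)"
proof -
  let ?m = "monomial :: _ \<Rightarrow> ('n, 'k) mpoly"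
  let ?N = "nonconst_monomials D :: ('n, 'k) mpoly set"
  let ?P = "divisors a - {0, a}"
  let ?B = "\<lambda>x. if x = ?m a then {True} else if x \<in> ?m ` ?P then {False} else UNIV"
  have meq: "?m b = ?m c \<longleftrightarrow> b = c" for b c
    by (rule inj_eq[OF inj_monomial])
  have "{f. a \<in> minimal_exponents {b. b \<noteq> 0 \<and> total_degree b \<le> D \<and> f (?m b)}} = Pi ?N ?B"
  proof (intro set_eqI)
    fix f
    \<comment> \<open>Every monomial constrained by the event lies in the range of the random choice.\<close>
    have P: "b \<noteq> 0 \<and> total_degree b \<le> D" if "b \<in> insert a ?P" for b
      using that a total_degree_divisor_le[of b a] by auto
    have "a \<in> minimal_exponents {b. b \<noteq> 0 \<and> total_degree b \<le> D \<and> f (?m b)}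
        \<longleftrightarrow> f (?m a) \<and> (\<forall>b\<in>?P. \<not> f (?m b))"
      using a P by (auto simp: minimal_exponents_def)
    also have "\<dots> \<longleftrightarrow> (\<forall>b\<in>insert a ?P. f (?m b) \<in> ?B (?m b))"
      by (auto simp: meq image_iff)
    also have "\<dots> \<longleftrightarrow> (\<forall>b\<in>{b. b \<noteq> 0 \<and> total_degree b \<le> D}. f (?m b) \<in> ?B (?m b))"
      using P by (auto simp: meq image_iff)
    also have "\<dots> \<longleftrightarrow> f \<in> Pi ?N ?B"
      by (simp add: nonconst_monomials_def Pi_iff)
    finally show "f \<in> {f. a \<in> minimal_exponents {b. b \<noteq> 0 \<and> total_degree b \<le> D \<and> f (?m b)}}
        \<longleftrightarrow> f \<in> Pi ?N ?B"
      by simp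
  qed
  then have "measure_pmf.prob (Pi_pmf ?N False (\<lambda>_. bernoulli_pmf p))
      {f. a \<in> minimal_exponents {b. b \<noteq> 0 \<and> total_degree b \<le> D \<and> f (?m b)}}
    = (\<Prod>x\<in>?N. measure_pmf.prob (bernoulli_pmf p) (?B x))"
    by (simp add: measure_Pi_pmf_Pi finite_nonconst_monomials)
  also have "\<dots> = (\<Prod>x\<in>?m ` (insert a ?P). measure_pmf.prob (bernoulli_pmf p) (?B x))"
    using a total_degree_divisor_le
    by (intro prod.mono_neutral_right finite_nonconst_monomials)
      (auto simp: nonconst_monomials_def intro: order_trans)
  also have "\<dots> = (\<Prod>x\<in>insert a ?P. measure_pmf.prob (bernoulli_pmf p) (?B (?m x)))"
    by (simp only: prod.reindex[OF inj_on_subset[OF inj_monomial subset_UNIV]] o_def)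
  also have "\<dots> = measure_pmf.prob (bernoulli_pmf p) (?B (?m a)) * (\<Prod>x\<in>?P. measure_pmf.prob (bernoulli_pmf p) (?B (?m x)))"
    using divisors_finite_card[of a] by (subst prod.insert) auto
  also have "(\<Prod>x\<in>?P. measure_pmf.prob (bernoulli_pmf p) (?B (?m x))) = (\<Prod>x\<in>?P. 1 - p)"
    using assms by (intro prod.cong) (auto simp: meq measure_pmf_single)
  finally show ?thesis
    using assms by (simp add: measure_pmf_single card_proper_nonconst_divisors)
qed

text \<open>The number of minimal generators is a sum of indicators, one for each candidate \<open>a\<close>.\<close>

lemma expectation_beta1:
  fixes p :: real
  assumes "0 \<le> p" "p \<le> 1"
  shows "measure_pmf.expectation (random_monomial_ideal D p :: ('n::finite, 'k::field) mpoly set pmf)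
      (\<lambda>I. real (beta1 I)) =
    p * (\<Sum>a | (a :: 'n \<Rightarrow>\<^sub>0 nat) \<noteq> 0 \<and> total_degree a \<le> D. (1 - p) ^ (divisor_count a - 2))"
proof -
  let ?A = "{a :: 'n \<Rightarrow>\<^sub>0 nat. a \<noteq> 0 \<and> total_degree a \<le> D}"
  let ?N = "nonconst_monomials D :: ('n, 'k) mpoly set"
  let ?M = "Pi_pmf ?N False (\<lambda>_. bernoulli_pmf p)"
  let ?E = "\<lambda>f. {b :: 'n \<Rightarrow>\<^sub>0 nat. b \<noteq> 0 \<and> total_degree b \<le> D \<and> f (monomial b :: ('n, 'k) mpoly)}"
  have finA: "finite ?A"
    by (rule finite_subset[OF _ finite_total_degree_le[of D]]) auto
  have "real (beta1 (ideal_of {m \<in> ?N. f m})) = (\<Sum>a\<in>?A. indicator {f. a \<in> minimal_exponents (?E f)} f)" for f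
  proof -
    have "{m \<in> ?N. f m} = monomial ` ?E f"
      by (auto simp: nonconst_monomials_def)
    moreover have "{a \<in> ?A. a \<in> minimal_exponents (?E f)} = minimal_exponents (?E f)"
      by (auto simp: minimal_exponents_def)
    ultimately show ?thesis
      using finA by (simp add: beta1_eq_card_minimal_exponents indicator_def sum.If_cases Int_def)
  qed
  then have "measure_pmf.expectation (random_monomial_ideal D p :: ('n, 'k) mpoly set pmf) (\<lambda>I. real (beta1 I))
    = measure_pmf.expectation ?M (\<lambda>f. \<Sum>a\<in>?A. indicator {f. a \<in> minimal_exponents (?E f)} f)"
    by (simp add: random_monomial_ideal_def random_monomials_def)
  also have "\<dots> = (\<Sum>a\<in>?A. measure_pmf.prob ?M {f. a \<in> minimal_exponents (?E f)})"
    by (subst Bochner_Integration.integral_sum) (auto simp: measure_pmf.emeasure_eq_measure)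
  also have "\<dots> = (\<Sum>a\<in>?A. p * (1 - p) ^ (divisor_count a - 2))"
    using assms by (intro sum.cong) (auto simp: prob_minimal_exponent)
  finally show ?thesis by (simp add: sum_distrib_left)
qed

theorem theorem4p1:
  fixes p :: real
  assumes "0 < p" and "p \<le> 1"
  shows "summable (\<lambda>k. real (tau CARD('n::finite) (k + 2)) * (1 - p) ^ k) \<and>
    (\<lambda>D. measure_pmf.expectation
            (random_monomial_ideal D p :: ('n, 'k::field) mpoly set pmf)
            (\<lambda>I. real (beta1 I)))
      \<longlonglongrightarrow> p * suminf (\<lambda>k. real (tau CARD('n) (k + 2)) * (1 - p) ^ k)"
proof
  define q where "q = 1 - p"
  have q: "0 \<le> q" "q < 1" using assms by (simp_all add: q_def)
  let ?t = "\<lambda>k. real (tau CARD('n) (k + 2)) * q ^ k"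
  let ?w = "\<lambda>a :: 'n \<Rightarrow>\<^sub>0 nat. q ^ (divisor_count a - 2)"
  let ?A = "\<lambda>D. {a :: 'n \<Rightarrow>\<^sub>0 nat. a \<noteq> 0 \<and> total_degree a \<le> D}"
  let ?C = "\<lambda>N. {a :: 'n \<Rightarrow>\<^sub>0 nat. 2 \<le> divisor_count a \<and> divisor_count a < N + 2}"
  show summable: "summable (\<lambda>k. real (tau CARD('n) (k + 2)) * (1 - p) ^ k)"
    using summable_tau_power[OF q] by (simp add: q_def)
  have finA: "finite (?A D)" for D
    by (rule finite_subset[OF _ finite_total_degree_le[of D]]) auto
  have finC: "finite (?C N)" for N
    by (rule finite_subset[OF _ finite_divisor_count_less[of "N + 2"]]) auto
  \<comment> \<open>A vector with fewer than \<open>D + 2\<close> divisors has degree at most \<open>D\<close>.\<close>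
  have lower: "(\<Sum>k<D. ?t k) \<le> sum ?w (?A D)" for D
    unfolding sum_tau_power
  proof (rule sum_mono2[OF finA])
    show "?C D \<subseteq> ?A D"
    proof clarify
      fix a :: "'n \<Rightarrow>\<^sub>0 nat" assume "2 \<le> divisor_count a" "divisor_count a < D + 2"
      then show "a \<noteq> 0 \<and> total_degree a \<le> D"
        using total_degree_less_divisor_count[of a] by (auto simp: divisor_count_zero)
    qed
  qed (use q in auto)
  \<comment> \<open>The divisor counts of the finitely many vectors involved are bounded, so a partial sum covers them all.\<close>
  have upper: "sum ?w (?A D) \<le> suminf ?t" for D
  proof -
    obtain N where N: "\<forall>a\<in>?A D. divisor_count a < N"
      using finA[of D] finite_nat_set_iff_bounded[of "divisor_count ` ?A D"]
      by auto
    have "sum ?w (?A D) \<le> sum ?w (?C N)"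
    proof (rule sum_mono2[OF finC])
      show "?A D \<subseteq> ?C N"
        using N divisor_count_ge_2 by fastforce
    qed (use q in auto)
    also have "\<dots> = (\<Sum>k<N. ?t k)"
      by (rule sum_tau_power[symmetric])
    also have "\<dots> \<le> suminf ?t"
      using summable q by (intro sum_le_suminf) (auto simp: q_def)
    finally show ?thesis .
  qed
  have "(\<lambda>D. sum ?w (?A D)) \<longlonglongrightarrow> suminf ?t"
  proof (rule tendsto_sandwich)
    show "(\<lambda>D. \<Sum>k<D. ?t k) \<longlonglongrightarrow> suminf ?t"
      using summable by (intro summable_LIMSEQ) (simp add: q_def)
  qed (use lower upper in auto)
  then show "(\<lambda>D. measure_pmf.expectation
            (random_monomial_ideal D p :: ('n, 'k) mpoly set pmf) (\<lambda>I. real (beta1 I)))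
      \<longlonglongrightarrow> p * suminf (\<lambda>k. real (tau CARD('n) (k + 2)) * (1 - p) ^ k)"
    using assms by (simp add: expectation_beta1 q_def tendsto_mult_left)
qed

end
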